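(* Let $\#$ be a parametrized monad on a category $\mathbf{C}$ with finite coproducts. (i) Suppose $\mathsf{out}_X:\Phi X\to X\#\Phi X$ is a final coalgebra for the functor $X\#(-)$, with inverse $\mathsf{out}_X^{-1}$. Then $\Phi X$, equipped with the $\#$-algebra structure $\mathsf{out}_X^{-1}\circ m^{\Phi X}_X\circ(\mathsf{out}_X\#\mathrm{id}_{\Phi X}):\Phi X\#\Phi X\to\Phi X$ and a suitable iteration operator, is a free complete Elgot $\#$-algebra on $X$ with universal morphism $\mathsf{out}_X^{-1}\circ u^{\Phi X}_X:X\to\Phi X$. (ii) Suppose $\varphi_X:FX\#FX\to FX$ (with some iteration operator) and $\eta_X:X\to FX$ form a free complete Elgot $\#$-algebra on $X$. Then $\varphi_X\circ(\eta_X\#\mathrm{id}_{FX}):X\#FX\to FX$ is an isomorphism, and its inverse is the structure of a final coalgebra for the functor $X\#(-)$.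
   Context: A parametrized monad is a bifunctor $\#:\mathbf{C}\times\mathbf{C}\to\mathbf{C}$ such that each $(-)\#X$ is a monad with unit $u^X_A:A\to A\#X$ and multiplication $m^X_A:(A\#X)\#X\to A\#X$, and for each $f:X\to Y$ the family $(\mathrm{id}_Z\#f)_Z$ is a monad morphism. A $\#$-algebra is $(A,a)$ with $a:A\#A\to A$, $a\circ u^A_A=\mathrm{id}$, $a\circ(a\#\mathrm{id})=a\circ m^A_A$. A complete Elgot $\#$-algebra is a $\#$-algebra $(A,a)$ with an operator sending each $e:X\to A\#X$ to $e^\dagger:X\to A$ such that: (solution) $e^\dagger=a\circ(\mathrm{id}_A\#e^\dagger)\circ e$; (functoriality) for $e:X\to A\#X$, $f:Y\to A\#Y$, $h:X\to Y$, if $f\circ h=(\mathrm{id}_A\#h)\circ e$ then $f^\dagger\circ h=e^\dagger$; (compositionality) for $f:Y\to A\#Y$ and $g:X\to Y\#X$, putting $f^\dagger\bullet g=(f^\dagger\#\mathrm{id}_X)\circ g$ and $f\blacksquare g=m^{Y+X}_A\circ(((\mathrm{id}_A\#\mathsf{inl})\circ f)\#\mathsf{inr})\circ[u^X_Y,g]:Y+X\to A\#(Y+X)$, one has $(f\blacksquare g)^\dagger\circ\mathsf{inr}=(f^\dagger\bullet g)^\dagger$. A morphism of complete Elgot $\#$-algebras $(A,a,\dagger)\to(B,b,\ddagger)$ is $f:A\to B$ with $((f\#\mathrm{id}_X)\circ e)^\ddagger=f\circ e^\dagger$ for all $e:X\to A\#X$. A free complete Elgot $\#$-algebra on $X$ is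 a complete Elgot $\#$-algebra $FX$ with a morphism $\eta_X:X\to FX$ such that for every complete Elgot $\#$-algebra $B$ and every morphism $g:X\to B$ there is a unique morphism of complete Elgot $\#$-algebras $\bar g:FX\to B$ with $\bar g\circ\eta_X=g$. *)

theory Defs
  imports Main
begin

record ('o, 'm) cat =
  Ob :: "'o set"
  Ar :: "'m set"
  Dom :: "'m \<Rightarrow> 'o"
  Cod :: "'m \<Rightarrow> 'o"
  Id :: "'o \<Rightarrow> 'm" ("\<one>\<index>")
  Comp :: "'m \<Rightarrow> 'm \<Rightarrow> 'm" (infixr "\<cdot>\<index>" 70)

definition Hom :: "('o, 'm, 'x) cat_scheme \<Rightarrow> 'o \<Rightarrow> 'o \<Rightarrow> 'm set"
  where "Hom C A B = {f \<in> Ar C. Dom C f = A \<and> Cod C f = B}"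

locale category =
  fixes C :: "('o, 'm, 'x) cat_scheme" (structure)
  assumes Dom_Ob: "f \<in> Ar C \<Longrightarrow> Dom C f \<in> Ob C"
    and Cod_Ob: "f \<in> Ar C \<Longrightarrow> Cod C f \<in> Ob C"
    and Id_Hom: "A \<in> Ob C \<Longrightarrow> \<one> A \<in> Hom C A A"
    and Comp_Hom: "f \<in> Hom C A B \<Longrightarrow> g \<in> Hom C B D \<Longrightarrow> g \<cdot> f \<in> Hom C A D"
    and Id_left: "f \<in> Hom C A B \<Longrightarrow> \<one> B \<cdot> f = f"
    and Id_right: "f \<in> Hom C A B \<Longrightarrow> f \<cdot> \<one> A = f"
    and Comp_assoc: "f \<in> Hom C A B \<Longrightarrow> g \<in> Hom C B D \<Longrightarrow> h \<in> Hom C D E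
      \<Longrightarrow> (h \<cdot> g) \<cdot> f = h \<cdot> (g \<cdot> f)"

definition is_inverse :: "('o, 'm, 'x) cat_scheme \<Rightarrow> 'm \<Rightarrow> 'm \<Rightarrow> bool"
  where "is_inverse C f g \<longleftrightarrow>
    f \<in> Ar C \<and> g \<in> Hom C (Cod C f) (Dom C f) \<and>
    g \<cdot>\<^bsub>C\<^esub> f = \<one>\<^bsub>C\<^esub> (Dom C f) \<and> f \<cdot>\<^bsub>C\<^esub> g = \<one>\<^bsub>C\<^esub> (Cod C f)"

definition is_iso :: "('o, 'm, 'x) cat_scheme \<Rightarrow> 'm \<Rightarrow> bool"
  where "is_iso C f \<longleftrightarrow> (\<exists>g. is_inverse C f g)"

definition inverse_of :: "('o, 'm, 'x) cat_scheme \<Rightarrow> 'm \<Rightarrow> 'm"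
  where "inverse_of C f = (THE g. is_inverse C f g)"


subsection \<open>Endofunctors, monads and coalgebras\<close>

definition endofunctor :: "('o, 'm, 'x) cat_scheme \<Rightarrow> ('o \<Rightarrow> 'o) \<Rightarrow> ('m \<Rightarrow> 'm) \<Rightarrow> bool"
  where "endofunctor C Fo Fm \<longleftrightarrow>
    (\<forall>A\<in>Ob C. Fo A \<in> Ob C) \<and>
    (\<forall>A B. \<forall>f\<in>Hom C A B. Fm f \<in> Hom C (Fo A) (Fo B)) \<and>
    (\<forall>A\<in>Ob C. Fm (\<one>\<^bsub>C\<^esub> A) = \<one>\<^bsub>C\<^esub> (Fo A)) \<and>
    (\<forall>A B D. \<forall>f\<in>Hom C A B. \<forall>g\<in>Hom C B D. Fm (g \<cdot>\<^bsub>C\<^esub> f) = Fm g \<cdot>\<^bsub>C\<^esub> Fm f)"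

definition natural_transformation ::
  "('o, 'm, 'x) cat_scheme \<Rightarrow> ('o \<Rightarrow> 'o) \<Rightarrow> ('m \<Rightarrow> 'm) \<Rightarrow> ('o \<Rightarrow> 'o) \<Rightarrow> ('m \<Rightarrow> 'm) \<Rightarrow> ('o \<Rightarrow> 'm) \<Rightarrow> bool"
  where "natural_transformation C Fo Fm Go Gm \<theta> \<longleftrightarrow>
    (\<forall>A\<in>Ob C. \<theta> A \<in> Hom C (Fo A) (Go A)) \<and>
    (\<forall>A B. \<forall>f\<in>Hom C A B. \<theta> B \<cdot>\<^bsub>C\<^esub> Fm f = Gm f \<cdot>\<^bsub>C\<^esub> \<theta> A)"

definition monad ::
  "('o, 'm, 'x) cat_scheme \<Rightarrow> ('o \<Rightarrow> 'o) \<Rightarrow> ('m \<Rightarrow> 'm) \<Rightarrow> ('o \<Rightarrow> 'm) \<Rightarrow> ('o \<Rightarrow> 'm) \<Rightarrow> bool"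
  where "monad C To Tm u m \<longleftrightarrow>
    endofunctor C To Tm \<and>
    natural_transformation C (\<lambda>A. A) (\<lambda>f. f) To Tm u \<and>
    natural_transformation C (\<lambda>A. To (To A)) (\<lambda>f. Tm (Tm f)) To Tm m \<and>
    (\<forall>A\<in>Ob C. m A \<cdot>\<^bsub>C\<^esub> u (To A) = \<one>\<^bsub>C\<^esub> (To A)) \<and>
    (\<forall>A\<in>Ob C. m A \<cdot>\<^bsub>C\<^esub> Tm (u A) = \<one>\<^bsub>C\<^esub> (To A)) \<and>
    (\<forall>A\<in>Ob C. m A \<cdot>\<^bsub>C\<^esub> Tm (m A) = m A \<cdot>\<^bsub>C\<^esub> m (To A))"

definition monad_morphism ::
  "('o, 'm, 'x) cat_scheme \<Rightarrow> ('o \<Rightarrow> 'o) \<Rightarrow> ('m \<Rightarrow> 'm) \<Rightarrow> ('o \<Rightarrow> 'm) \<Rightarrow> ('o \<Rightarrow> 'm) \<Rightarrow>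
    ('o \<Rightarrow> 'o) \<Rightarrow> ('m \<Rightarrow> 'm) \<Rightarrow> ('o \<Rightarrow> 'm) \<Rightarrow> ('o \<Rightarrow> 'm) \<Rightarrow> ('o \<Rightarrow> 'm) \<Rightarrow> bool"
  where "monad_morphism C To Tm u m So Sm u' m' \<theta> \<longleftrightarrow>
    natural_transformation C To Tm So Sm \<theta> \<and>
    (\<forall>A\<in>Ob C. \<theta> A \<cdot>\<^bsub>C\<^esub> u A = u' A) \<and>
    (\<forall>A\<in>Ob C. \<theta> A \<cdot>\<^bsub>C\<^esub> m A = m' A \<cdot>\<^bsub>C\<^esub> Sm (\<theta> A) \<cdot>\<^bsub>C\<^esub> \<theta> (To A))"

definition coalgebra ::
  "('o, 'm, 'x) cat_scheme \<Rightarrow> ('o \<Rightarrow> 'o) \<Rightarrow> 'o \<Rightarrow> 'm \<Rightarrow> bool"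
  where "coalgebra C Fo A c \<longleftrightarrow> A \<in> Ob C \<and> c \<in> Hom C A (Fo A)"

definition coalgebra_morphism ::
  "('o, 'm, 'x) cat_scheme \<Rightarrow> ('m \<Rightarrow> 'm) \<Rightarrow> 'o \<Rightarrow> 'm \<Rightarrow> 'o \<Rightarrow> 'm \<Rightarrow> 'm \<Rightarrow> bool"
  where "coalgebra_morphism C Fm A c B d h \<longleftrightarrow>
    h \<in> Hom C A B \<and> d \<cdot>\<^bsub>C\<^esub> h = Fm h \<cdot>\<^bsub>C\<^esub> c"

definition final_coalgebra ::
  "('o, 'm, 'x) cat_scheme \<Rightarrow> ('o \<Rightarrow> 'o) \<Rightarrow> ('m \<Rightarrow> 'm) \<Rightarrow> 'o \<Rightarrow> 'm \<Rightarrow> bool"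
  where "final_coalgebra C Fo Fm A c \<longleftrightarrow>
    coalgebra C Fo A c \<and>
    (\<forall>B d. coalgebra C Fo B d \<longrightarrow> (\<exists>!h. coalgebra_morphism C Fm B d A c h))"

text \<open>The next two lemmas (uniqueness of inverses and Lambek's lemma) show that
  \<^const>\<open>inverse_of\<close> yields the actual inverse of the structure map of a final coalgebra.\<close>

lemma (in category) inverse_of_is_inverse:
  assumes "is_iso C f"
  shows "is_inverse C f (inverse_of C f)"
proof -
  obtain g where g: "is_inverse C f g" using assms by (auto simp: is_iso_def)
  have "h = g" if h: "is_inverse C f h" for h
  proof -
    let ?A = "Dom C f" and ?B = "Cod C f"
    have f: "f \<in> Hom C ?A ?B" using g by (auto simp: is_inverse_def Hom_def)
    have gh: "g \<in> Hom C ?B ?A" "h \<in> Hom C ?B ?A" using g h by (auto simp: is_inverse_def)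
    have "h = h \<cdot> (f \<cdot> g)" using g gh by (simp add: is_inverse_def Id_right)
    also have "\<dots> = (h \<cdot> f) \<cdot> g" using f gh by (simp add: Comp_assoc)
    also have "\<dots> = g" using h gh by (simp add: is_inverse_def Id_left)
    finally show ?thesis .
  qed
  with g show ?thesis unfolding inverse_of_def by (rule theI)
qed

lemma (in category) final_coalgebra_is_iso:
  assumes F: "endofunctor C Fo Fm" and fin: "final_coalgebra C Fo Fm A c"
  shows "is_iso C c"
proof -
  have A: "A \<in> Ob C" and c: "c \<in> Hom C A (Fo A)"
    using fin by (auto simp: final_coalgebra_def coalgebra_def)
  have Fc: "Fm c \<in> Hom C (Fo A) (Fo (Fo A))" and FA: "Fo A \<in> Ob C"
    using F c A unfolding endofunctor_def by blast+
  then have "coalgebra C Fo (Fo A) (Fm c)" by (simp add: coalgebra_def)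
  then obtain h where h: "h \<in> Hom C (Fo A) A" and hc: "c \<cdot> h = Fm h \<cdot> Fm c"
    using fin unfolding final_coalgebra_def coalgebra_morphism_def by metis
  have Fh: "Fm h \<in> Hom C (Fo (Fo A)) (Fo A)" using F h unfolding endofunctor_def by blast
  have Fhc: "Fm (h \<cdot> c) = Fm h \<cdot> Fm c" using F h c unfolding endofunctor_def by blast
  have "c \<cdot> (h \<cdot> c) = (c \<cdot> h) \<cdot> c" using Comp_assoc[OF c h c] by simp
  also have "\<dots> = Fm (h \<cdot> c) \<cdot> c" using hc Fhc by simp
  finally have 1: "coalgebra_morphism C Fm A c A c (h \<cdot> c)"
    using Comp_Hom[OF c h] by (simp add: coalgebra_morphism_def)
  have FI: "Fm (\<one> A) = \<one> (Fo A)" using F A unfolding endofunctor_def by blast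
  have 2: "coalgebra_morphism C Fm A c A c (\<one> A)"
    using Id_Hom[OF A] FI Id_left[OF c] Id_right[OF c] by (simp add: coalgebra_morphism_def)
  have "h \<cdot> c = \<one> A"
    using fin 1 2 unfolding final_coalgebra_def by blast
  moreover from this have "c \<cdot> h = \<one> (Fo A)" using hc Fhc FI by simp
  ultimately show ?thesis using c h
    by (auto simp: is_iso_def is_inverse_def Hom_def)
qed


subsection \<open>Finite coproducts\<close>

record ('o, 'm) coprod_cat = "('o, 'm) cat" +
  Init :: "'o"
  Sum :: "'o \<Rightarrow> 'o \<Rightarrow> 'o" (infixr "\<boxplus>\<index>" 65)
  Inj1 :: "'o \<Rightarrow> 'o \<Rightarrow> 'm"
  Inj2 :: "'o \<Rightarrow> 'o \<Rightarrow> 'm"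

locale finite_coproducts = category C
  for C :: "('o, 'm, 'x) coprod_cat_scheme" (structure) +
  assumes Init_Ob: "Init C \<in> Ob C"
    and Init_unique: "A \<in> Ob C \<Longrightarrow> \<exists>!h. h \<in> Hom C (Init C) A"
    and Sum_Ob: "A \<in> Ob C \<Longrightarrow> B \<in> Ob C \<Longrightarrow> A \<boxplus> B \<in> Ob C"
    and Inj1_Hom: "A \<in> Ob C \<Longrightarrow> B \<in> Ob C \<Longrightarrow> Inj1 C A B \<in> Hom C A (A \<boxplus> B)"
    and Inj2_Hom: "A \<in> Ob C \<Longrightarrow> B \<in> Ob C \<Longrightarrow> Inj2 C A B \<in> Hom C B (A \<boxplus> B)"
    and Sum_universal: "f \<in> Hom C A D \<Longrightarrow> g \<in> Hom C B D
      \<Longrightarrow> \<exists>!h. h \<in> Hom C (A \<boxplus> B) D \<and> h \<cdot> Inj1 C A B = f \<and> h \<cdot> Inj2 C A B = g"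

definition copair :: "('o, 'm, 'x) coprod_cat_scheme \<Rightarrow> 'm \<Rightarrow> 'm \<Rightarrow> 'm"
  where "copair C f g =
    (THE h. h \<in> Hom C (Dom C f \<boxplus>\<^bsub>C\<^esub> Dom C g) (Cod C f) \<and>
      h \<cdot>\<^bsub>C\<^esub> Inj1 C (Dom C f) (Dom C g) = f \<and>
      h \<cdot>\<^bsub>C\<^esub> Inj2 C (Dom C f) (Dom C g) = g)"


subsection \<open>Parametrized monads\<close>

text \<open>\<open>A \<sharp> X\<close> and \<open>f \<sharp>\<sharp> g\<close> are the object and arrow parts of the bifunctor;
  \<open>Unit C X A : A \<rightarrow> A \<sharp> X\<close> and \<open>Mult C X A : (A \<sharp> X) \<sharp> X \<rightarrow> A \<sharp> X\<close>
  take the parameter \<open>X\<close> first.\<close>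

record ('o, 'm) pmonad_cat = "('o, 'm) coprod_cat" +
  TOb :: "'o \<Rightarrow> 'o \<Rightarrow> 'o" (infixl "\<sharp>\<index>" 75)
  TAr :: "'m \<Rightarrow> 'm \<Rightarrow> 'm" (infixl "\<sharp>\<sharp>\<index>" 75)
  Unit :: "'o \<Rightarrow> 'o \<Rightarrow> 'm"
  Mult :: "'o \<Rightarrow> 'o \<Rightarrow> 'm"

locale parametrized_monad = category C
  for C :: "('o, 'm, 'x) pmonad_cat_scheme" (structure) +
  assumes TOb_Ob: "A \<in> Ob C \<Longrightarrow> B \<in> Ob C \<Longrightarrow> A \<sharp> B \<in> Ob C"
    and TAr_Hom: "f \<in> Hom C A A' \<Longrightarrow> g \<in> Hom C B B' \<Longrightarrow> f \<sharp>\<sharp> g \<in> Hom C (A \<sharp> B) (A' \<sharp> B')"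
    and TAr_Id: "A \<in> Ob C \<Longrightarrow> B \<in> Ob C \<Longrightarrow> \<one> A \<sharp>\<sharp> \<one> B = \<one> (A \<sharp> B)"
    and TAr_Comp: "f \<in> Hom C A A' \<Longrightarrow> f' \<in> Hom C A' A'' \<Longrightarrow> g \<in> Hom C B B' \<Longrightarrow> g' \<in> Hom C B' B''
      \<Longrightarrow> (f' \<cdot> f) \<sharp>\<sharp> (g' \<cdot> g) = (f' \<sharp>\<sharp> g') \<cdot> (f \<sharp>\<sharp> g)"
    and monad_at: "X \<in> Ob C
      \<Longrightarrow> monad C (\<lambda>A. A \<sharp> X) (\<lambda>h. h \<sharp>\<sharp> \<one> X) (Unit C X) (Mult C X)"
    and monad_morphism_at: "f \<in> Hom C X Y
      \<Longrightarrow> monad_morphism C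
            (\<lambda>A. A \<sharp> X) (\<lambda>h. h \<sharp>\<sharp> \<one> X) (Unit C X) (Mult C X)
            (\<lambda>A. A \<sharp> Y) (\<lambda>h. h \<sharp>\<sharp> \<one> Y) (Unit C Y) (Mult C Y)
            (\<lambda>Z. \<one> Z \<sharp>\<sharp> f)"


subsection \<open>Complete Elgot algebras\<close>

definition sharp_algebra :: "('o, 'm, 'x) pmonad_cat_scheme \<Rightarrow> 'o \<Rightarrow> 'm \<Rightarrow> bool"
  where "sharp_algebra C A a \<longleftrightarrow>
    A \<in> Ob C \<and> a \<in> Hom C (A \<sharp>\<^bsub>C\<^esub> A) A \<and>
    a \<cdot>\<^bsub>C\<^esub> Unit C A A = \<one>\<^bsub>C\<^esub> A \<and>
    a \<cdot>\<^bsub>C\<^esub> (a \<sharp>\<sharp>\<^bsub>C\<^esub> \<one>\<^bsub>C\<^esub> A) = a \<cdot>\<^bsub>C\<^esub> Mult C A A"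

text \<open>For \<open>h : Y \<rightarrow> A\<close> and \<open>g : X \<rightarrow> Y \<sharp> X\<close>, \<open>bullet C X h g\<close> is \<open>h \<bullet> g : X \<rightarrow> A \<sharp> X\<close>.\<close>

definition bullet :: "('o, 'm, 'x) pmonad_cat_scheme \<Rightarrow> 'o \<Rightarrow> 'm \<Rightarrow> 'm \<Rightarrow> 'm"
  where "bullet C X h g = (h \<sharp>\<sharp>\<^bsub>C\<^esub> \<one>\<^bsub>C\<^esub> X) \<cdot>\<^bsub>C\<^esub> g"

text \<open>For \<open>f : Y \<rightarrow> A \<sharp> Y\<close> and \<open>g : X \<rightarrow> Y \<sharp> X\<close>, \<open>black_square C A Y X f g\<close> is the arrow
  \<open>Y \<boxplus> X \<rightarrow> A \<sharp> (Y \<boxplus> X)\<close> that runs \<open>g\<close> and then continues with \<open>f\<close>.\<close>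

definition black_square ::
  "('o, 'm, 'x) pmonad_cat_scheme \<Rightarrow> 'o \<Rightarrow> 'o \<Rightarrow> 'o \<Rightarrow> 'm \<Rightarrow> 'm \<Rightarrow> 'm"
  where "black_square C A Y X f g =
    Mult C (Y \<boxplus>\<^bsub>C\<^esub> X) A \<cdot>\<^bsub>C\<^esub>
    (((\<one>\<^bsub>C\<^esub> A \<sharp>\<sharp>\<^bsub>C\<^esub> Inj1 C Y X) \<cdot>\<^bsub>C\<^esub> f) \<sharp>\<sharp>\<^bsub>C\<^esub> Inj2 C Y X) \<cdot>\<^bsub>C\<^esub>
    copair C (Unit C X Y) g"

text \<open>The iteration operator is a function on arrows, constrained only on arrows \<open>e : X \<rightarrow> A \<sharp> X\<close>
  (where \<open>X\<close> is recovered as the domain of \<open>e\<close>).\<close>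

definition complete_elgot_algebra ::
  "('o, 'm, 'x) pmonad_cat_scheme \<Rightarrow> 'o \<Rightarrow> 'm \<Rightarrow> ('m \<Rightarrow> 'm) \<Rightarrow> bool"
  where "complete_elgot_algebra C A a dag \<longleftrightarrow>
    sharp_algebra C A a \<and>
    (\<forall>X\<in>Ob C. \<forall>e\<in>Hom C X (A \<sharp>\<^bsub>C\<^esub> X). dag e \<in> Hom C X A) \<and>
    (\<forall>X\<in>Ob C. \<forall>e\<in>Hom C X (A \<sharp>\<^bsub>C\<^esub> X).
      dag e = a \<cdot>\<^bsub>C\<^esub> (\<one>\<^bsub>C\<^esub> A \<sharp>\<sharp>\<^bsub>C\<^esub> dag e) \<cdot>\<^bsub>C\<^esub> e) \<and>
    (\<forall>X\<in>Ob C. \<forall>Y\<in>Ob C. \<forall>e\<in>Hom C X (A \<sharp>\<^bsub>C\<^esub> X). \<forall>f\<in>Hom C Y (A \<sharp>\<^bsub>C\<^esub> Y). \<forall>h\<in>Hom C X Y.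
      f \<cdot>\<^bsub>C\<^esub> h = (\<one>\<^bsub>C\<^esub> A \<sharp>\<sharp>\<^bsub>C\<^esub> h) \<cdot>\<^bsub>C\<^esub> e \<longrightarrow> dag f \<cdot>\<^bsub>C\<^esub> h = dag e) \<and>
    (\<forall>X\<in>Ob C. \<forall>Y\<in>Ob C. \<forall>f\<in>Hom C Y (A \<sharp>\<^bsub>C\<^esub> Y). \<forall>g\<in>Hom C X (Y \<sharp>\<^bsub>C\<^esub> X).
      dag (black_square C A Y X f g) \<cdot>\<^bsub>C\<^esub> Inj2 C Y X = dag (bullet C X (dag f) g))"

definition elgot_morphism ::
  "('o, 'm, 'x) pmonad_cat_scheme \<Rightarrow> 'o \<Rightarrow> ('m \<Rightarrow> 'm) \<Rightarrow> 'o \<Rightarrow> ('m \<Rightarrow> 'm) \<Rightarrow> 'm \<Rightarrow> bool"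
  where "elgot_morphism C A dag B ddag f \<longleftrightarrow>
    f \<in> Hom C A B \<and>
    (\<forall>X\<in>Ob C. \<forall>e\<in>Hom C X (A \<sharp>\<^bsub>C\<^esub> X).
      ddag ((f \<sharp>\<sharp>\<^bsub>C\<^esub> \<one>\<^bsub>C\<^esub> X) \<cdot>\<^bsub>C\<^esub> e) = f \<cdot>\<^bsub>C\<^esub> dag e)"

definition free_complete_elgot_algebra ::
  "('o, 'm, 'x) pmonad_cat_scheme \<Rightarrow> 'o \<Rightarrow> 'o \<Rightarrow> 'm \<Rightarrow> ('m \<Rightarrow> 'm) \<Rightarrow> 'm \<Rightarrow> bool"
  where "free_complete_elgot_algebra C X A a dag \<eta> \<longleftrightarrow>
    complete_elgot_algebra C A a dag \<and> \<eta> \<in> Hom C X A \<and>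
    (\<forall>B b ddag. complete_elgot_algebra C B b ddag \<longrightarrow>
      (\<forall>g\<in>Hom C X B. \<exists>!h. elgot_morphism C A dag B ddag h \<and> h \<cdot>\<^bsub>C\<^esub> \<eta> = g))"

end

theory Submission
  imports Defs
begin

text \<open>
  Let \<open>c : D \<rightarrow> X \<sharp> D\<close> be a coalgebra and \<open>a : D \<sharp> D \<rightarrow> D\<close> satisfy \<open>c \<cdot> a = m \<cdot> (c \<sharp>\<sharp> 1)\<close>. If \<open>c\<close> is
  monic, then \<open>s\<close> solves \<open>e : Z \<rightarrow> D \<sharp> Z\<close> iff \<open>[1, s]\<close> is a coalgebra morphism from the black square
  of \<open>c\<close> and \<open>e\<close> to \<open>c\<close>. Hence over a final coalgebra all solutions exist and are unique, which
  yields the Elgot axioms; the free extension of \<open>g : X \<rightarrow> B\<close> is the iterate of \<open>(g \<sharp>\<sharp> 1) \<cdot> out\<close>, and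
  it preserves iteration by compositionality and functoriality in \<open>B\<close>.

  Conversely, given a free algebra \<open>F\<close> with \<open>\<alpha> = \<phi> \<cdot> (\<eta> \<sharp>\<sharp> 1)\<close>, the object \<open>X \<sharp> F\<close> is a complete Elgot
  algebra with iteration \<open>e \<mapsto> m \<cdot> (1 \<sharp>\<sharp> ((\<alpha> \<sharp>\<sharp> 1) \<cdot> e)\<dagger>) \<cdot> e\<close>, and the extension \<open>\<beta>\<close> of the unit
  \<open>X \<rightarrow> X \<sharp> F\<close> is inverse to \<open>\<alpha>\<close>. Coalgebra morphisms from \<open>d\<close> to \<open>\<beta>\<close> are the solutions of
  \<open>(\<eta> \<sharp>\<sharp> 1) \<cdot> d\<close>, so one exists; by functoriality it is unique once the iterate of \<open>(\<eta> \<sharp>\<sharp> 1) \<cdot> \<beta>\<close>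
  is the identity, which holds because that iterate is an Elgot endomorphism fixing \<open>\<eta>\<close>.
\<close>

locale coproduct_pmonad = finite_coproducts C + parametrized_monad C
  for C :: "('o, 'm, 'x) pmonad_cat_scheme" (structure)
begin

text \<open>Typing is phrased through \<open>Dom\<close> and \<open>Cod\<close> instead of \<open>Hom\<close>, so that the side conditions of the
  categorical equations contain no unknown objects and the simplifier can discharge them. Composites
  are normalised by associating to the right, merging adjacent \<open>\<sharp>\<sharp>\<close> factors and moving \<open>Unit\<close> and
  \<open>Mult\<close> to the left.\<close>

lemma HomI: "f \<in> Ar C \<Longrightarrow> Dom C f = A \<Longrightarrow> Cod C f = B \<Longrightarrow> f \<in> Hom C A B"
  by (simp add: Hom_def)

lemma HomD:
  assumes "f \<in> Hom C A B"
  shows "f \<in> Ar C" "Dom C f = A" "Cod C f = B"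
  using assms by (simp_all add: Hom_def)

lemmas Ob_rules [simp] = Dom_Ob Cod_Ob TOb_Ob Sum_Ob

lemma Id_rules [simp]:
  assumes "A \<in> Ob C"
  shows "\<one> A \<in> Ar C" "Dom C (\<one> A) = A" "Cod C (\<one> A) = A"
  using HomD[OF Id_Hom[OF assms]] by simp_all

lemma Comp_rules [simp]:
  assumes "f \<in> Ar C" "g \<in> Ar C" "Dom C g = Cod C f"
  shows "g \<cdot> f \<in> Ar C" "Dom C (g \<cdot> f) = Dom C f" "Cod C (g \<cdot> f) = Cod C g"
  using HomD[OF Comp_Hom[OF HomI[OF assms(1) refl refl] HomI[OF assms(2,3) refl]]] by simp_all

lemma Id_comp [simp]: "f \<in> Ar C \<Longrightarrow> Cod C f = B \<Longrightarrow> \<one> B \<cdot> f = f"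
  by (rule Id_left[OF HomI]) simp_all

lemma comp_Id [simp]: "f \<in> Ar C \<Longrightarrow> Dom C f = A \<Longrightarrow> f \<cdot> \<one> A = f"
  by (rule Id_right[OF HomI]) simp_all

lemma assoc [simp]:
  "\<lbrakk>f \<in> Ar C; g \<in> Ar C; h \<in> Ar C; Dom C g = Cod C f; Dom C h = Cod C g\<rbrakk>
    \<Longrightarrow> (h \<cdot> g) \<cdot> f = h \<cdot> (g \<cdot> f)"
  by (rule Comp_assoc[OF HomI HomI HomI]) simp_all

lemma TAr_rules [simp]:
  assumes "f \<in> Ar C" "g \<in> Ar C"
  shows "f \<sharp>\<sharp> g \<in> Ar C" "Dom C (f \<sharp>\<sharp> g) = Dom C f \<sharp> Dom C g"
    "Cod C (f \<sharp>\<sharp> g) = Cod C f \<sharp> Cod C g"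
  using HomD[OF TAr_Hom[OF HomI[OF assms(1) refl refl] HomI[OF assms(2) refl refl]]] by simp_all

lemma TAr_merge [simp]:
  "\<lbrakk>f \<in> Ar C; f' \<in> Ar C; g \<in> Ar C; g' \<in> Ar C; Dom C f' = Cod C f; Dom C g' = Cod C g\<rbrakk>
    \<Longrightarrow> (f' \<sharp>\<sharp> g') \<cdot> (f \<sharp>\<sharp> g) = (f' \<cdot> f) \<sharp>\<sharp> (g' \<cdot> g)"
  by (rule TAr_Comp[symmetric, OF HomI HomI HomI HomI]) simp_all

text \<open>Right association hides the redex of \<open>TAr_merge\<close> once a further factor
  follows; the trailing \<open>k\<close> lets the rule match there. The later rules ending in
  \<open>_assoc\<close> serve the same purpose.\<close>

lemma TAr_merge_assoc [simp]:
  "\<lbrakk>f \<in> Ar C; f' \<in> Ar C; g \<in> Ar C; g' \<in> Ar C; k \<in> Ar C; Dom C f' = Cod C f; Dom C g' = Cod C g;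
    Cod C k = Dom C f \<sharp> Dom C g\<rbrakk>
    \<Longrightarrow> (f' \<sharp>\<sharp> g') \<cdot> ((f \<sharp>\<sharp> g) \<cdot> k) = ((f' \<cdot> f) \<sharp>\<sharp> (g' \<cdot> g)) \<cdot> k"
  by (simp flip: assoc)

lemmas [simp] = TAr_Id

section \<open>Naturality and monad laws of the parametrized monad\<close>

lemma Unit_Hom: "X \<in> Ob C \<Longrightarrow> A \<in> Ob C \<Longrightarrow> Unit C X A \<in> Hom C A (A \<sharp> X)"
  using monad_at[of X] unfolding monad_def natural_transformation_def by blast

lemma Mult_Hom: "X \<in> Ob C \<Longrightarrow> A \<in> Ob C \<Longrightarrow> Mult C X A \<in> Hom C (A \<sharp> X \<sharp> X) (A \<sharp> X)"
  using monad_at[of X] unfolding monad_def natural_transformation_def by blast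

lemma Unit_Mult_rules [simp]:
  assumes "X \<in> Ob C" "A \<in> Ob C"
  shows "Unit C X A \<in> Ar C" "Dom C (Unit C X A) = A" "Cod C (Unit C X A) = A \<sharp> X"
    "Mult C X A \<in> Ar C" "Dom C (Mult C X A) = A \<sharp> X \<sharp> X" "Cod C (Mult C X A) = A \<sharp> X"
  using HomD[OF Unit_Hom[OF assms]] HomD[OF Mult_Hom[OF assms]] by simp_all

text \<open>Joint naturality: \<open>f \<sharp>\<sharp> g\<close> splits into
  \<open>f \<sharp>\<sharp> \<one> X\<close> followed by a change of parameter along
  \<open>g\<close>. The first factor is handled by naturality of the unit for fixed parameter, the
  second by the unit law of the monad morphism.\<close>

lemma Unit_natural [simp]:
  assumes [simp]: "f \<in> Ar C" "g \<in> Ar C" "Dom C f = A" "Dom C g = X"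
  shows "(f \<sharp>\<sharp> g) \<cdot> Unit C X A = Unit C (Cod C g) (Cod C f) \<cdot> f"
proof -
  have [simp]: "A \<in> Ob C" "X \<in> Ob C" using Dom_Ob[of f] Dom_Ob[of g] by simp_all
  have 1: "Unit C X (Cod C f) \<cdot> f = (f \<sharp>\<sharp> \<one> X) \<cdot> Unit C X A"
    using monad_at[of X] HomI[of f A "Cod C f"]
    unfolding monad_def natural_transformation_def by simp
  have 2: "(\<one> (Cod C f) \<sharp>\<sharp> g) \<cdot> Unit C X (Cod C f) = Unit C (Cod C g) (Cod C f)"
    using monad_morphism_at[OF HomI[of g X "Cod C g"]] unfolding monad_morphism_def by simp
  have "(f \<sharp>\<sharp> g) \<cdot> Unit C X A = (\<one> (Cod C f) \<sharp>\<sharp> g) \<cdot> ((f \<sharp>\<sharp> \<one> X) \<cdot> Unit C X A)" by simp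
  also have "\<dots> = ((\<one> (Cod C f) \<sharp>\<sharp> g) \<cdot> Unit C X (Cod C f)) \<cdot> f" by (simp flip: 1)
  finally show ?thesis by (simp only: 2)
qed

text \<open>The same splitting as for the unit. The multiplication law of the monad morphism changes
  the parameter in both layers, hence \<open>g\<close> occurs twice on the right.\<close>

lemma Mult_natural [simp]:
  assumes [simp]: "f \<in> Ar C" "g \<in> Ar C" "Dom C f = A" "Dom C g = X"
  shows "(f \<sharp>\<sharp> g) \<cdot> Mult C X A = Mult C (Cod C g) (Cod C f) \<cdot> ((f \<sharp>\<sharp> g) \<sharp>\<sharp> g)"
proof -
  let ?B = "Cod C f"
  have [simp]: "A \<in> Ob C" "X \<in> Ob C" using Dom_Ob[of f] Dom_Ob[of g] by simp_all
  have 1: "Mult C X ?B \<cdot> ((f \<sharp>\<sharp> \<one> X) \<sharp>\<sharp> \<one> X) = (f \<sharp>\<sharp> \<one> X) \<cdot> Mult C X A"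
    using monad_at[of X] HomI[of f A ?B]
    unfolding monad_def natural_transformation_def by simp
  have 2: "(\<one> ?B \<sharp>\<sharp> g) \<cdot> Mult C X ?B =
      Mult C (Cod C g) ?B \<cdot> ((\<one> ?B \<sharp>\<sharp> g) \<sharp>\<sharp> \<one> (Cod C g)) \<cdot> (\<one> (?B \<sharp> X) \<sharp>\<sharp> g)"
    using monad_morphism_at[OF HomI[of g X "Cod C g"]] unfolding monad_morphism_def by simp
  have "(f \<sharp>\<sharp> g) \<cdot> Mult C X A = (\<one> ?B \<sharp>\<sharp> g) \<cdot> ((f \<sharp>\<sharp> \<one> X) \<cdot> Mult C X A)" by simp
  also have "\<dots> = ((\<one> ?B \<sharp>\<sharp> g) \<cdot> Mult C X ?B) \<cdot> ((f \<sharp>\<sharp> \<one> X) \<sharp>\<sharp> \<one> X)" by (simp flip: 1)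
  also have "\<dots> = Mult C (Cod C g) ?B \<cdot> ((f \<sharp>\<sharp> g) \<sharp>\<sharp> g)" by (simp only: 2) simp
  finally show ?thesis .
qed

lemma Mult_natural_assoc [simp]:
  assumes [simp]: "f \<in> Ar C" "g \<in> Ar C" "k \<in> Ar C" "Dom C f = A" "Dom C g = X"
    "Cod C k = A \<sharp> X \<sharp> X"
  shows "(f \<sharp>\<sharp> g) \<cdot> (Mult C X A \<cdot> k) = Mult C (Cod C g) (Cod C f) \<cdot> (((f \<sharp>\<sharp> g) \<sharp>\<sharp> g) \<cdot> k)"
proof -
  have [simp]: "A \<in> Ob C" "X \<in> Ob C" using Dom_Ob[of f] Dom_Ob[of g] by simp_all
  show ?thesis by (simp flip: assoc)
qed

lemma Mult_Unit [simp]: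
  "X \<in> Ob C \<Longrightarrow> A \<in> Ob C \<Longrightarrow> Mult C X A \<cdot> Unit C X (A \<sharp> X) = \<one> (A \<sharp> X)"
  using monad_at[of X] unfolding monad_def by simp

lemma Mult_Unit_assoc [simp]:
  "\<lbrakk>X \<in> Ob C; A \<in> Ob C; k \<in> Ar C; Cod C k = A \<sharp> X\<rbrakk>
    \<Longrightarrow> Mult C X A \<cdot> (Unit C X (A \<sharp> X) \<cdot> k) = k"
  by (simp flip: assoc)

text \<open>Merging of \<open>\<sharp>\<sharp>\<close> factors absorbs neighbouring arrows into the
  unit factor, so the bare unit law would rarely match; \<open>f\<close> and \<open>g\<close>
  account for what has been absorbed.\<close>

lemma Mult_TAr_Unit [simp]:
  assumes [simp]: "f \<in> Ar C" "g \<in> Ar C" "Cod C f = A" "Cod C g = X" "A \<in> Ob C" "X \<in> Ob C"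
  shows "Mult C X A \<cdot> ((Unit C X A \<cdot> f) \<sharp>\<sharp> g) = f \<sharp>\<sharp> g"
proof -
  have *: "Mult C X A \<cdot> (Unit C X A \<sharp>\<sharp> \<one> X) = \<one> (A \<sharp> X)"
    using monad_at[of X] unfolding monad_def by simp
  have "Mult C X A \<cdot> ((Unit C X A \<cdot> f) \<sharp>\<sharp> g)
      = (Mult C X A \<cdot> (Unit C X A \<sharp>\<sharp> \<one> X)) \<cdot> (f \<sharp>\<sharp> g)" by simp
  then show ?thesis unfolding * by simp
qed

lemma Mult_TAr_Unit_assoc [simp]:
  "\<lbrakk>f \<in> Ar C; g \<in> Ar C; k \<in> Ar C; Cod C f = A; Cod C g = X; A \<in> Ob C; X \<in> Ob C;
    Cod C k = Dom C f \<sharp> Dom C g\<rbrakk>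
    \<Longrightarrow> Mult C X A \<cdot> (((Unit C X A \<cdot> f) \<sharp>\<sharp> g) \<cdot> k) = (f \<sharp>\<sharp> g) \<cdot> k"
  by (simp flip: assoc[of k _ "Mult C X A"])

text \<open>The case \<open>f = \<one> A\<close> of the two preceding rules, stated separately
  because simplification has already removed the identity from the pattern.\<close>

lemma Mult_TAr_Unit_Id [simp]:
  "\<lbrakk>g \<in> Ar C; Cod C g = X; A \<in> Ob C; X \<in> Ob C\<rbrakk>
    \<Longrightarrow> Mult C X A \<cdot> (Unit C X A \<sharp>\<sharp> g) = \<one> A \<sharp>\<sharp> g"
  "\<lbrakk>g \<in> Ar C; Cod C g = X; A \<in> Ob C; X \<in> Ob C; k \<in> Ar C; Cod C k = A \<sharp> Dom C g\<rbrakk>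
    \<Longrightarrow> Mult C X A \<cdot> ((Unit C X A \<sharp>\<sharp> g) \<cdot> k) = (\<one> A \<sharp>\<sharp> g) \<cdot> k"
  using Mult_TAr_Unit[of "\<one> A" g A X] Mult_TAr_Unit_assoc[of "\<one> A" g k A X] by simp_all

lemma Mult_TAr_Mult [simp]:
  assumes [simp]: "f \<in> Ar C" "g \<in> Ar C" "Cod C f = A \<sharp> X \<sharp> X" "Cod C g = X" "A \<in> Ob C" "X \<in> Ob C"
  shows "Mult C X A \<cdot> ((Mult C X A \<cdot> f) \<sharp>\<sharp> g) = Mult C X A \<cdot> (Mult C X (A \<sharp> X) \<cdot> (f \<sharp>\<sharp> g))"
proof -
  have *: "Mult C X A \<cdot> (Mult C X A \<sharp>\<sharp> \<one> X) = Mult C X A \<cdot> Mult C X (A \<sharp> X)"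
    using monad_at[of X] unfolding monad_def by simp
  have "Mult C X A \<cdot> ((Mult C X A \<cdot> f) \<sharp>\<sharp> g)
      = (Mult C X A \<cdot> (Mult C X A \<sharp>\<sharp> \<one> X)) \<cdot> (f \<sharp>\<sharp> g)" by simp
  then show ?thesis unfolding * by simp
qed

lemma Mult_TAr_Mult_assoc [simp]:
  "\<lbrakk>f \<in> Ar C; g \<in> Ar C; k \<in> Ar C; Cod C f = A \<sharp> X \<sharp> X; Cod C g = X; A \<in> Ob C; X \<in> Ob C;
    Cod C k = Dom C f \<sharp> Dom C g\<rbrakk>
    \<Longrightarrow> Mult C X A \<cdot> (((Mult C X A \<cdot> f) \<sharp>\<sharp> g) \<cdot> k)
      = Mult C X A \<cdot> (Mult C X (A \<sharp> X) \<cdot> ((f \<sharp>\<sharp> g) \<cdot> k))"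
  by (simp flip: assoc[of k _ "Mult C X A"])

section \<open>Coproducts and the black square\<close>

lemma Inj_rules [simp]:
  assumes "A \<in> Ob C" "B \<in> Ob C"
  shows "Inj1 C A B \<in> Ar C" "Dom C (Inj1 C A B) = A" "Cod C (Inj1 C A B) = A \<boxplus> B"
    "Inj2 C A B \<in> Ar C" "Dom C (Inj2 C A B) = B" "Cod C (Inj2 C A B) = A \<boxplus> B"
  using HomD[OF Inj1_Hom[OF assms]] HomD[OF Inj2_Hom[OF assms]] by simp_all

lemma copair_rules [simp]:
  assumes "f \<in> Ar C" "g \<in> Ar C" "Cod C g = Cod C f" "Dom C f = A" "Dom C g = B"
  shows "copair C f g \<in> Ar C" "Dom C (copair C f g) = A \<boxplus> B"
    "Cod C (copair C f g) = Cod C f"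
    "copair C f g \<cdot> Inj1 C A B = f" "copair C f g \<cdot> Inj2 C A B = g"
  using theI'[OF Sum_universal[OF HomI[OF assms(1) refl refl] HomI[OF assms(2) refl assms(3)]]] assms
  unfolding copair_def by (simp_all add: Hom_def)

lemma Sum_ext:
  assumes "s \<in> Ar C" "t \<in> Ar C" "Dom C s = A \<boxplus> B" "Dom C t = A \<boxplus> B" "Cod C s = Cod C t"
    "A \<in> Ob C" "B \<in> Ob C"
    "s \<cdot> Inj1 C A B = t \<cdot> Inj1 C A B" "s \<cdot> Inj2 C A B = t \<cdot> Inj2 C A B"
  shows "s = t"
proof -
  have "t \<cdot> Inj1 C A B \<in> Hom C A (Cod C t)" "t \<cdot> Inj2 C A B \<in> Hom C B (Cod C t)"
    using assms(1-7) by (auto intro!: HomI)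
  from Sum_universal[OF this] show ?thesis using assms by (auto simp: Hom_def)
qed

lemma black_square_rules [simp]:
  assumes [simp]: "f \<in> Ar C" "g \<in> Ar C" "Dom C f = Y" "Dom C g = Z"
    "Cod C f = A \<sharp> Y" "Cod C g = Y \<sharp> Z" "A \<in> Ob C"
  shows "black_square C A Y Z f g \<in> Ar C"
    "Dom C (black_square C A Y Z f g) = Y \<boxplus> Z"
    "Cod C (black_square C A Y Z f g) = A \<sharp> (Y \<boxplus> Z)"
    "black_square C A Y Z f g \<cdot> Inj1 C Y Z = (\<one> A \<sharp>\<sharp> Inj1 C Y Z) \<cdot> f"
    "black_square C A Y Z f g \<cdot> Inj2 C Y Z =
      Mult C (Y \<boxplus> Z) A \<cdot> ((((\<one> A \<sharp>\<sharp> Inj1 C Y Z) \<cdot> f) \<sharp>\<sharp> Inj2 C Y Z) \<cdot> g)"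
proof -
  have [simp]: "Y \<in> Ob C" "Z \<in> Ob C" using Dom_Ob[of f] Dom_Ob[of g] by simp_all
  show "black_square C A Y Z f g \<in> Ar C"
    "Dom C (black_square C A Y Z f g) = Y \<boxplus> Z"
    "Cod C (black_square C A Y Z f g) = A \<sharp> (Y \<boxplus> Z)"
    "black_square C A Y Z f g \<cdot> Inj1 C Y Z = (\<one> A \<sharp>\<sharp> Inj1 C Y Z) \<cdot> f"
    "black_square C A Y Z f g \<cdot> Inj2 C Y Z =
      Mult C (Y \<boxplus> Z) A \<cdot> ((((\<one> A \<sharp>\<sharp> Inj1 C Y Z) \<cdot> f) \<sharp>\<sharp> Inj2 C Y Z) \<cdot> g)"
    by (simp_all add: black_square_def)
qed

text \<open>Naturality of \<open>Mult\<close> on the right summand, plain merging on the left. It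
  allows the output type of the first arrow to be changed outside the black square.\<close>

lemma TAr_black_square:
  assumes [simp]: "f \<in> Ar C" "g \<in> Ar C" "Dom C f = Y" "Dom C g = Z" "h \<in> Ar C" "Dom C h = A"
    "Cod C f = A \<sharp> Y" "Cod C g = Y \<sharp> Z" "A \<in> Ob C" "Cod C h = B"
  shows "black_square C B Y Z ((h \<sharp>\<sharp> \<one> Y) \<cdot> f) g = (h \<sharp>\<sharp> \<one> (Y \<boxplus> Z)) \<cdot> black_square C A Y Z f g"
proof -
  have [simp]: "Y \<in> Ob C" "Z \<in> Ob C" "B \<in> Ob C"
    using Dom_Ob[of f] Dom_Ob[of g] Cod_Ob[of h] by simp_all
  show ?thesis by (rule Sum_ext[where A = Y and B = Z]) simp_all
qed

section \<open>Algebras, Elgot axioms and Elgot morphisms\<close>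

lemma sharp_algebra_rules:
  assumes "sharp_algebra C A a"
  shows "A \<in> Ob C" "a \<in> Ar C" "Dom C a = A \<sharp> A" "Cod C a = A"
    "a \<cdot> Unit C A A = \<one> A"
    "\<And>k. k \<in> Ar C \<Longrightarrow> Cod C k = A \<Longrightarrow> a \<cdot> (Unit C A A \<cdot> k) = k"
    "a \<cdot> Mult C A A = a \<cdot> (a \<sharp>\<sharp> \<one> A)"
    "\<And>k. k \<in> Ar C \<Longrightarrow> Cod C k = A \<sharp> A \<sharp> A \<Longrightarrow> a \<cdot> (Mult C A A \<cdot> k) = a \<cdot> ((a \<sharp>\<sharp> \<one> A) \<cdot> k)"
proof -
  show r [simp]: "A \<in> Ob C" "a \<in> Ar C" "Dom C a = A \<sharp> A" "Cod C a = A"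
    and u: "a \<cdot> Unit C A A = \<one> A" and m: "a \<cdot> Mult C A A = a \<cdot> (a \<sharp>\<sharp> \<one> A)"
    using assms by (auto simp: sharp_algebra_def Hom_def)
  show "a \<cdot> (Unit C A A \<cdot> k) = k" if "k \<in> Ar C" "Cod C k = A" for k
    using that by (simp add: u flip: assoc)
  show "a \<cdot> (Mult C A A \<cdot> k) = a \<cdot> ((a \<sharp>\<sharp> \<one> A) \<cdot> k)" if "k \<in> Ar C" "Cod C k = A \<sharp> A \<sharp> A" for k
    using that by (simp add: m flip: assoc)
qed

lemma elgot_algebra_rules:
  assumes "complete_elgot_algebra C A a dag"
  shows "sharp_algebra C A a"
    "\<And>e Z. \<lbrakk>e \<in> Ar C; Dom C e = Z; Cod C e = A \<sharp> Z\<rbrakk> \<Longrightarrow> dag e \<in> Ar C"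
    "\<And>e Z. \<lbrakk>e \<in> Ar C; Dom C e = Z; Cod C e = A \<sharp> Z\<rbrakk> \<Longrightarrow> Dom C (dag e) = Z"
    "\<And>e Z. \<lbrakk>e \<in> Ar C; Dom C e = Z; Cod C e = A \<sharp> Z\<rbrakk> \<Longrightarrow> Cod C (dag e) = A"
  using assms Dom_Ob unfolding complete_elgot_algebra_def Hom_def by auto

lemma elgot_solution:
  assumes "complete_elgot_algebra C A a dag" "e \<in> Ar C" "Dom C e = Z" "Cod C e = A \<sharp> Z"
  shows "a \<cdot> ((\<one> A \<sharp>\<sharp> dag e) \<cdot> e) = dag e"
  using assms HomI[of e Z] Dom_Ob[of e] unfolding complete_elgot_algebra_def by metis

lemma elgot_functoriality:
  assumes "complete_elgot_algebra C A a dag"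
    and "e \<in> Ar C" "Dom C e = Z" "Cod C e = A \<sharp> Z" "f \<in> Ar C" "Dom C f = Y" "Cod C f = A \<sharp> Y"
    and "h \<in> Ar C" "Dom C h = Z" "Cod C h = Y" "f \<cdot> h = (\<one> A \<sharp>\<sharp> h) \<cdot> e"
  shows "dag f \<cdot> h = dag e"
  using assms HomI[of e Z "A \<sharp> Z"] HomI[of f Y "A \<sharp> Y"] HomI[of h Z Y] Dom_Ob[of e] Dom_Ob[of f]
  unfolding complete_elgot_algebra_def by blast

lemma elgot_compositionality:
  assumes "complete_elgot_algebra C A a dag"
    and "f \<in> Ar C" "Dom C f = Y" "Cod C f = A \<sharp> Y" "g \<in> Ar C" "Dom C g = Z" "Cod C g = Y \<sharp> Z"
  shows "dag (black_square C A Y Z f g) \<cdot> Inj2 C Y Z = dag ((dag f \<sharp>\<sharp> \<one> Z) \<cdot> g)"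
  using assms HomI[of f Y "A \<sharp> Y"] HomI[of g Z "Y \<sharp> Z"] Dom_Ob[of f] Dom_Ob[of g]
  unfolding complete_elgot_algebra_def bullet_def by blast

lemma elgot_morphismD:
  assumes "elgot_morphism C A dag B ddag h"
  shows "h \<in> Ar C" "Dom C h = A" "Cod C h = B"
    "\<And>e Z. \<lbrakk>e \<in> Ar C; Dom C e = Z; Cod C e = A \<sharp> Z\<rbrakk> \<Longrightarrow> ddag ((h \<sharp>\<sharp> \<one> Z) \<cdot> e) = h \<cdot> dag e"
proof -
  fix e Z assume e: "e \<in> Ar C" "Dom C e = Z" "Cod C e = A \<sharp> Z"
  then have "Z \<in> Ob C" by auto
  then show "ddag ((h \<sharp>\<sharp> \<one> Z) \<cdot> e) = h \<cdot> dag e"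
    using assms HomI[OF e] unfolding elgot_morphism_def by blast
qed (use assms in \<open>auto simp: elgot_morphism_def Hom_def\<close>)

lemma elgot_morphismI:
  assumes "h \<in> Ar C" "Dom C h = A" "Cod C h = B"
    "\<And>e Z. \<lbrakk>e \<in> Ar C; Dom C e = Z; Cod C e = A \<sharp> Z; Z \<in> Ob C\<rbrakk> \<Longrightarrow> ddag ((h \<sharp>\<sharp> \<one> Z) \<cdot> e) = h \<cdot> dag e"
  shows "elgot_morphism C A dag B ddag h"
  using assms unfolding elgot_morphism_def by (auto simp: Hom_def)

lemma elgot_morphism_comp:
  assumes A: "complete_elgot_algebra C A a dag"
    and h: "elgot_morphism C A dag B ddag h" and k: "elgot_morphism C B ddag D dddag k"
  shows "elgot_morphism C A dag D dddag (k \<cdot> h)"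
proof -
  note [simp] = elgot_morphismD(1-3)[OF h] elgot_morphismD(1-3)[OF k] elgot_algebra_rules[OF A]
  show ?thesis
  proof (rule elgot_morphismI)
    fix e Z assume [simp]: "e \<in> Ar C" "Dom C e = Z" "Cod C e = A \<sharp> Z" "Z \<in> Ob C"
    have "dddag (((k \<cdot> h) \<sharp>\<sharp> \<one> Z) \<cdot> e) = dddag ((k \<sharp>\<sharp> \<one> Z) \<cdot> ((h \<sharp>\<sharp> \<one> Z) \<cdot> e))" by simp
    also have "\<dots> = k \<cdot> (h \<cdot> dag e)"
      by (subst elgot_morphismD(4)[OF k]) (simp_all add: elgot_morphismD(4)[OF h])
    finally show "dddag (((k \<cdot> h) \<sharp>\<sharp> \<one> Z) \<cdot> e) = (k \<cdot> h) \<cdot> dag e" by simp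
  qed simp_all
qed

section \<open>Elgot algebras from unique solutions\<close>

text \<open>Functoriality and compositionality each equate two arrows, the second of which is an
  iterate; it suffices that the first satisfies the solution equation of that iterate.\<close>

lemma unique_solutions_elgot:
  assumes alg: "sharp_algebra C A a"
    and dag: "\<And>e Z. \<lbrakk>e \<in> Ar C; Dom C e = Z; Cod C e = A \<sharp> Z; Z \<in> Ob C\<rbrakk>
      \<Longrightarrow> dag e \<in> Hom C Z A \<and> dag e = a \<cdot> (\<one> A \<sharp>\<sharp> dag e) \<cdot> e"
    and uniq: "\<And>e Z s. \<lbrakk>e \<in> Ar C; Dom C e = Z; Cod C e = A \<sharp> Z; Z \<in> Ob C;
      s \<in> Ar C; Dom C s = Z; Cod C s = A; s = a \<cdot> (\<one> A \<sharp>\<sharp> s) \<cdot> e\<rbrakk> \<Longrightarrow> s = dag e"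
  shows "complete_elgot_algebra C A a dag"
proof -
  note [simp] = sharp_algebra_rules[OF alg]
  have D [simp]: "dag e \<in> Ar C" "Dom C (dag e) = Z" "Cod C (dag e) = A"
    if "e \<in> Ar C" "Dom C e = Z" "Cod C e = A \<sharp> Z" for e Z
    using dag[of e Z] that Dom_Ob[of e] by (auto simp: Hom_def)
  have sol: "a \<cdot> ((\<one> A \<sharp>\<sharp> dag e) \<cdot> e) = dag e"
    if "e \<in> Ar C" "Dom C e = Z" "Cod C e = A \<sharp> Z" for e Z
    using dag[of e Z] that Dom_Ob[of e] by auto
  have functorial: "dag f \<cdot> h = dag e"
    if [simp]: "e \<in> Ar C" "Dom C e = Z" "Cod C e = A \<sharp> Z" "f \<in> Ar C" "Dom C f = Y" "Cod C f = A \<sharp> Y"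
      "h \<in> Ar C" "Dom C h = Z" "Cod C h = Y" and fh: "f \<cdot> h = (\<one> A \<sharp>\<sharp> h) \<cdot> e" for e f h Y Z
  proof (rule uniq)
    have [simp]: "Z \<in> Ob C" "Y \<in> Ob C" using Dom_Ob[of e] Dom_Ob[of f] by simp_all
    show "Z \<in> Ob C" by simp
    have "dag f \<cdot> h = (a \<cdot> ((\<one> A \<sharp>\<sharp> dag f) \<cdot> f)) \<cdot> h" by (simp only: sol[of f Y] that)
    also have "\<dots> = a \<cdot> (\<one> A \<sharp>\<sharp> (dag f \<cdot> h)) \<cdot> e" by (simp add: fh)
    finally show "dag f \<cdot> h = a \<cdot> (\<one> A \<sharp>\<sharp> (dag f \<cdot> h)) \<cdot> e" .
  qed simp_all
  have "dag (black_square C A Y Z f g) \<cdot> Inj2 C Y Z = dag ((dag f \<sharp>\<sharp> \<one> Z) \<cdot> g)"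
    if [simp]: "f \<in> Ar C" "Dom C f = Y" "Cod C f = A \<sharp> Y" "g \<in> Ar C" "Dom C g = Z" "Cod C g = Y \<sharp> Z"
      "Y \<in> Ob C" "Z \<in> Ob C" for f g Y Z
  proof (rule uniq)
    let ?bs = "black_square C A Y Z f g"
    let ?s = "dag ?bs" and ?r = "dag ?bs \<cdot> Inj2 C Y Z"
    \<comment> \<open>The left injection is a homomorphism from \<open>f\<close> to the black
      square, so the functoriality just proved applies.\<close>
    have [simp]: "?s \<cdot> Inj1 C Y Z = dag f"
      by (rule functorial[of _ Y _ "Y \<boxplus> Z"]) simp_all
    have "?r = (a \<cdot> ((\<one> A \<sharp>\<sharp> ?s) \<cdot> ?bs)) \<cdot> Inj2 C Y Z" by (subst sol) simp_all
    \<comment> \<open>The algebra law turns the multiplication inside the black square into a nested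
      \<open>a\<close>, which exposes the solution equation of \<open>f\<close> in the left
      argument.\<close>
    also have "\<dots> = a \<cdot> (((a \<cdot> ((\<one> A \<sharp>\<sharp> dag f) \<cdot> f)) \<sharp>\<sharp> ?r) \<cdot> g)"
      by simp
    also have "\<dots> = a \<cdot> (\<one> A \<sharp>\<sharp> ?r) \<cdot> (dag f \<sharp>\<sharp> \<one> Z) \<cdot> g"
      by (subst sol) simp_all
    finally show "?r = a \<cdot> (\<one> A \<sharp>\<sharp> ?r) \<cdot> (dag f \<sharp>\<sharp> \<one> Z) \<cdot> g" .
  qed simp_all
  then show ?thesis
    unfolding complete_elgot_algebra_def bullet_def using alg sol functorial
    by (auto simp: Hom_def)
qed

text \<open>The structure map \<open>a\<close> is itself recovered from iteration, as the left component of the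
  iterate of \<open>[1 \<sharp>\<sharp> inr, u] : (A \<sharp> A) + A \<rightarrow> A \<sharp> ((A \<sharp> A) + A)\<close>.\<close>

lemma elgot_morphism_algebra_morphism:
  assumes A: "complete_elgot_algebra C A a dag" and B: "complete_elgot_algebra C B b ddag"
    and h: "elgot_morphism C A dag B ddag h"
  shows "h \<cdot> a = b \<cdot> (h \<sharp>\<sharp> h)"
proof -
  note [simp] = elgot_algebra_rules[OF A] elgot_algebra_rules[OF B] elgot_morphismD(1-3)[OF h]
    sharp_algebra_rules[OF elgot_algebra_rules(1)[OF A]] sharp_algebra_rules[OF elgot_algebra_rules(1)[OF B]]
  let ?l = "Inj1 C (A \<sharp> A) A" and ?r = "Inj2 C (A \<sharp> A) A" and ?S = "(A \<sharp> A) \<boxplus> A"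
  let ?e = "copair C (\<one> A \<sharp>\<sharp> ?r) (Unit C ?S A)"
  have e: "a \<cdot> ((\<one> A \<sharp>\<sharp> dag ?e) \<cdot> ?e) = dag ?e"
    by (rule elgot_solution[OF A]) simp_all
  \<comment> \<open>On the right summand \<open>?e\<close> is the unit, so the solution equation
    collapses to the identity. On the left summand \<open>?e\<close> sends the parameter to the
    right summand, where the iterate is the identity, so only \<open>a\<close> remains.\<close>
  have "(a \<cdot> ((\<one> A \<sharp>\<sharp> dag ?e) \<cdot> ?e)) \<cdot> ?r = \<one> A" by simp
  then have r: "dag ?e \<cdot> ?r = \<one> A" by (simp only: e)
  have "(a \<cdot> ((\<one> A \<sharp>\<sharp> dag ?e) \<cdot> ?e)) \<cdot> ?l = a" by (simp add: r)
  then have l: "dag ?e \<cdot> ?l = a" by (simp only: e)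
  have he: "ddag ((h \<sharp>\<sharp> \<one> ?S) \<cdot> ?e) = h \<cdot> dag ?e"
    by (rule elgot_morphismD(4)[OF h]) simp_all
  \<comment> \<open>The solution equation in \<open>B\<close> for the image of \<open>?e\<close>;
    restricted to the left summand it becomes the claim.\<close>
  have "b \<cdot> ((\<one> B \<sharp>\<sharp> ddag ((h \<sharp>\<sharp> \<one> ?S) \<cdot> ?e)) \<cdot> ((h \<sharp>\<sharp> \<one> ?S) \<cdot> ?e)) = h \<cdot> dag ?e"
    by (subst elgot_solution[OF B]) (simp_all add: he del: TAr_merge_assoc)
  then have "(b \<cdot> ((h \<sharp>\<sharp> (h \<cdot> dag ?e)) \<cdot> ?e)) \<cdot> ?l = (h \<cdot> dag ?e) \<cdot> ?l"
    by (simp add: he)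
  then show ?thesis by (simp add: l r)
qed

section \<open>Solutions as coalgebra morphisms\<close>

text \<open>On the left summand the morphism equation holds for every \<open>s\<close>, since
  \<open>t\<close> is the identity there. On the right summand \<open>ca\<close> moves
  \<open>c\<close> past \<open>a\<close>, which leaves the solution equation with \<open>c\<close>
  applied to both sides.\<close>

lemma solution_iff_coalgebra_morphism:
  assumes [simp]: "c \<in> Ar C" "Dom C c = D" "Cod C c = X \<sharp> D" "X \<in> Ob C"
    and [simp]: "a \<in> Ar C" "Dom C a = D \<sharp> D" "Cod C a = D"
    and ca: "c \<cdot> a = Mult C D X \<cdot> (c \<sharp>\<sharp> \<one> D)"
    and [simp]: "e \<in> Ar C" "Dom C e = Z" "Cod C e = D \<sharp> Z"
    and [simp]: "s \<in> Ar C" "Dom C s = Z" "Cod C s = D"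
  defines "t \<equiv> copair C (\<one> D) s"
  shows "c \<cdot> t = (\<one> X \<sharp>\<sharp> t) \<cdot> black_square C X D Z c e \<longleftrightarrow> c \<cdot> s = c \<cdot> (a \<cdot> ((\<one> D \<sharp>\<sharp> s) \<cdot> e))"
    (is "?L = ?R \<longleftrightarrow> _")
proof -
  have [simp]: "D \<in> Ob C" "Z \<in> Ob C" using Dom_Ob[of c] Dom_Ob[of e] by simp_all
  have [simp]: "t \<in> Ar C" "Dom C t = D \<boxplus> Z" "Cod C t = D" "t \<cdot> Inj1 C D Z = \<one> D"
    "t \<cdot> Inj2 C D Z = s" by (simp_all add: t_def)
  have "c \<cdot> (a \<cdot> ((\<one> D \<sharp>\<sharp> s) \<cdot> e)) = (c \<cdot> a) \<cdot> ((\<one> D \<sharp>\<sharp> s) \<cdot> e)" by simp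
  also have "\<dots> = ?R \<cdot> Inj2 C D Z" unfolding ca by simp
  finally have r: "?R \<cdot> Inj2 C D Z = c \<cdot> (a \<cdot> ((\<one> D \<sharp>\<sharp> s) \<cdot> e))" ..
  have l: "?L \<cdot> Inj1 C D Z = ?R \<cdot> Inj1 C D Z" "?L \<cdot> Inj2 C D Z = c \<cdot> s" by simp_all
  show ?thesis
  proof
    assume "?L = ?R"
    then show "c \<cdot> s = c \<cdot> (a \<cdot> ((\<one> D \<sharp>\<sharp> s) \<cdot> e))" using l(2) r by simp
  next
    assume *: "c \<cdot> s = c \<cdot> (a \<cdot> ((\<one> D \<sharp>\<sharp> s) \<cdot> e))"
    show "?L = ?R"
      by (rule Sum_ext[where A = D and B = Z]) (simp_all only: l r *, simp_all)
  qed
qed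

text \<open>Used in both directions, with \<open>c\<close> the final coalgebra and with
  \<open>c\<close> the inverse of the structure map of the free algebra. Functoriality along
  \<open>[1, s]\<close> identifies \<open>h\<close> after \<open>[1, s]\<close> with the iterate of
  a black square, and compositionality evaluates that iterate on the right summand.\<close>

lemma iterated_coalgebra_preserves_solutions:
  assumes B: "complete_elgot_algebra C B b ddag"
    and [simp]: "c \<in> Ar C" "Dom C c = D" "Cod C c = X \<sharp> D" "X \<in> Ob C"
    and [simp]: "a \<in> Ar C" "Dom C a = D \<sharp> D" "Cod C a = D"
    and ca: "c \<cdot> a = Mult C D X \<cdot> (c \<sharp>\<sharp> \<one> D)"
    and [simp]: "g \<in> Ar C" "Dom C g = X" "Cod C g = B"
    and [simp]: "e \<in> Ar C" "Dom C e = Z" "Cod C e = D \<sharp> Z"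
    and [simp]: "s \<in> Ar C" "Dom C s = Z" "Cod C s = D"
    and sol: "a \<cdot> ((\<one> D \<sharp>\<sharp> s) \<cdot> e) = s"
  defines "h \<equiv> ddag ((g \<sharp>\<sharp> \<one> D) \<cdot> c)"
  shows "ddag ((h \<sharp>\<sharp> \<one> Z) \<cdot> e) = h \<cdot> s"
proof -
  note [simp] = elgot_algebra_rules[OF B] sharp_algebra_rules[OF elgot_algebra_rules(1)[OF B]]
  have [simp]: "D \<in> Ob C" "Z \<in> Ob C" using Dom_Ob[of c] Dom_Ob[of e] by simp_all
  let ?f = "(g \<sharp>\<sharp> \<one> D) \<cdot> c" and ?t = "copair C (\<one> D) s"
  let ?bs = "black_square C B D Z ?f e"
  have ct: "c \<cdot> ?t = (\<one> X \<sharp>\<sharp> ?t) \<cdot> black_square C X D Z c e"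
    by (subst solution_iff_coalgebra_morphism[where a = a]) (simp_all add: ca sol)
  have h [simp]: "h \<in> Ar C" "Dom C h = D" "Cod C h = B" by (simp_all add: h_def)
  have "h \<cdot> ?t = ddag ?bs"
    unfolding h_def
    by (rule elgot_functoriality[OF B, of _ "D \<boxplus> Z" _ D]) (simp_all add: ct TAr_black_square[where A = X])
  then have "(h \<cdot> ?t) \<cdot> Inj2 C D Z = ddag ?bs \<cdot> Inj2 C D Z" by simp
  also have "\<dots> = ddag ((h \<sharp>\<sharp> \<one> Z) \<cdot> e)"
    unfolding h_def by (rule elgot_compositionality[OF B]) simp_all
  finally show ?thesis by simp
qed

lemma endofunctor_TAr: "X \<in> Ob C \<Longrightarrow> endofunctor C (\<lambda>Y. X \<sharp> Y) (\<lambda>h. \<one> X \<sharp>\<sharp> h)"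
  by (auto simp: endofunctor_def Hom_def)

section \<open>From final coalgebras to free algebras\<close>

theorem final_coalgebra_free_elgot:
  assumes X [simp]: "X \<in> Ob C"
    and fin: "final_coalgebra C (\<lambda>Y. X \<sharp> Y) (\<lambda>h. \<one> X \<sharp>\<sharp> h) D out"
  shows "\<exists>dag. free_complete_elgot_algebra C X D
    (inverse_of C out \<cdot> Mult C D X \<cdot> (out \<sharp>\<sharp> \<one> D)) dag (inverse_of C out \<cdot> Unit C D X)"
proof -
  have D [simp]: "D \<in> Ob C" and out [simp]: "out \<in> Ar C" "Dom C out = D" "Cod C out = X \<sharp> D"
    using fin by (auto simp: final_coalgebra_def coalgebra_def Hom_def)
  define tuo where "tuo = inverse_of C out"
  have "is_inverse C out tuo"
    unfolding tuo_def by (intro inverse_of_is_inverse final_coalgebra_is_iso[OF endofunctor_TAr[OF X] fin])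
  then have tuo [simp]: "tuo \<in> Ar C" "Dom C tuo = X \<sharp> D" "Cod C tuo = D"
    and inv1: "tuo \<cdot> out = \<one> D" and inv2: "out \<cdot> tuo = \<one> (X \<sharp> D)"
    by (auto simp: is_inverse_def Hom_def)
  have inv1' [simp]: "tuo \<cdot> (out \<cdot> k) = k" if "k \<in> Ar C" "Cod C k = D" for k
    using that by (simp add: inv1 flip: assoc)
  have inv2' [simp]: "out \<cdot> (tuo \<cdot> k) = k" if "k \<in> Ar C" "Cod C k = X \<sharp> D" for k
    using that by (simp add: inv2 flip: assoc)
  note [simp] = inv1 inv2
  \<comment> \<open>For the monad with parameter \<open>D\<close>, the free algebra on
    \<open>X\<close> is \<open>X \<sharp> D\<close> with \<open>Mult C D X\<close>; \<open>a\<close>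
    is its structure transported along \<open>out\<close>.\<close>
  define a where "a = tuo \<cdot> (Mult C D X \<cdot> (out \<sharp>\<sharp> \<one> D))"
  have a [simp]: "a \<in> Ar C" "Dom C a = D \<sharp> D" "Cod C a = D" by (simp_all add: a_def)
  have oa: "out \<cdot> a = Mult C D X \<cdot> (out \<sharp>\<sharp> \<one> D)" by (simp add: a_def)
  have alg: "sharp_algebra C D a"
    unfolding sharp_algebra_def by (auto simp: a_def intro!: HomI)
  define dag where "dag = (\<lambda>e. THE s. s \<in> Hom C (Dom C e) D \<and> s = a \<cdot> ((\<one> D \<sharp>\<sharp> s) \<cdot> e))"
  have ex1: "\<exists>!s. s \<in> Hom C Z D \<and> s = a \<cdot> ((\<one> D \<sharp>\<sharp> s) \<cdot> e)"
    if [simp]: "e \<in> Ar C" "Dom C e = Z" "Cod C e = D \<sharp> Z" "Z \<in> Ob C" for e Z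
  proof -
    let ?bs = "black_square C X D Z out e"
    \<comment> \<open>\<open>out\<close> is monic because \<open>tuo\<close> is a left
      inverse.\<close>
    have cancel: "out \<cdot> s = out \<cdot> s' \<longleftrightarrow> s = s'" if "s \<in> Hom C Z D" "s' \<in> Hom C Z D" for s s'
      using that inv1' by (metis HomD(1,3))
    have iff: "out \<cdot> copair C (\<one> D) s = (\<one> X \<sharp>\<sharp> copair C (\<one> D) s) \<cdot> ?bs \<longleftrightarrow> s = a \<cdot> ((\<one> D \<sharp>\<sharp> s) \<cdot> e)"
      if s: "s \<in> Hom C Z D" for s
    proof -
      note [simp] = HomD[OF s]
      show ?thesis
        by (subst solution_iff_coalgebra_morphism[where a = a]) (auto simp: oa intro!: HomI cancel)
    qed
    have "coalgebra C (\<lambda>Y. X \<sharp> Y) (D \<boxplus> Z) ?bs" by (auto simp: coalgebra_def intro!: HomI)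
    then obtain t where t: "coalgebra_morphism C (\<lambda>h. \<one> X \<sharp>\<sharp> h) (D \<boxplus> Z) ?bs D out t"
      and t_uniq: "\<And>t'. coalgebra_morphism C (\<lambda>h. \<one> X \<sharp>\<sharp> h) (D \<boxplus> Z) ?bs D out t' \<Longrightarrow> t' = t"
      using fin unfolding final_coalgebra_def by metis
    have tH [simp]: "t \<in> Ar C" "Dom C t = D \<boxplus> Z" "Cod C t = D"
      and ot: "out \<cdot> t = (\<one> X \<sharp>\<sharp> t) \<cdot> ?bs"
      using t by (auto simp: coalgebra_morphism_def Hom_def)
    \<comment> \<open>The left component of \<open>t\<close> is an endomorphism of the final
      coalgebra, hence the identity. So \<open>t\<close> has the form \<open>[1, s]\<close> required
      by \<open>iff\<close>.\<close>
    have "out \<cdot> (t \<cdot> Inj1 C D Z) = (\<one> X \<sharp>\<sharp> (t \<cdot> Inj1 C D Z)) \<cdot> out"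
    proof -
      have "out \<cdot> (t \<cdot> Inj1 C D Z) = (out \<cdot> t) \<cdot> Inj1 C D Z" by simp
      also have "\<dots> = (\<one> X \<sharp>\<sharp> (t \<cdot> Inj1 C D Z)) \<cdot> out" unfolding ot by simp
      finally show ?thesis .
    qed
    then have "coalgebra_morphism C (\<lambda>h. \<one> X \<sharp>\<sharp> h) D out D out (t \<cdot> Inj1 C D Z)"
      by (auto simp: coalgebra_morphism_def intro!: HomI)
    moreover have "coalgebra_morphism C (\<lambda>h. \<one> X \<sharp>\<sharp> h) D out D out (\<one> D)"
      by (auto simp: coalgebra_morphism_def intro!: HomI)
    moreover have "coalgebra C (\<lambda>Y. X \<sharp> Y) D out" using fin by (simp add: final_coalgebra_def)
    ultimately have t1: "t \<cdot> Inj1 C D Z = \<one> D"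
      using fin unfolding final_coalgebra_def by blast
    have "t = copair C (\<one> D) (t \<cdot> Inj2 C D Z)"
      by (rule Sum_ext[where A = D and B = Z]) (simp_all add: t1)
    then have "t \<cdot> Inj2 C D Z \<in> Hom C Z D" 
      "t \<cdot> Inj2 C D Z = a \<cdot> ((\<one> D \<sharp>\<sharp> (t \<cdot> Inj2 C D Z)) \<cdot> e)"
      using iff[of "t \<cdot> Inj2 C D Z"] ot by (auto simp: Hom_def)
    moreover have "s = t \<cdot> Inj2 C D Z" if s: "s \<in> Hom C Z D" "s = a \<cdot> ((\<one> D \<sharp>\<sharp> s) \<cdot> e)" for s
    proof -
      note [simp] = HomD[OF s(1)]
      have "copair C (\<one> D) s = t"
        using iff[OF s(1)] s(2) by (intro t_uniq) (auto simp: coalgebra_morphism_def intro!: HomI)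
      then have "copair C (\<one> D) s \<cdot> Inj2 C D Z = t \<cdot> Inj2 C D Z" by simp
      then show ?thesis by simp
    qed
    ultimately show ?thesis by blast
  qed
  have dag: "dag e \<in> Hom C Z D \<and> dag e = a \<cdot> ((\<one> D \<sharp>\<sharp> dag e) \<cdot> e)"
    if "e \<in> Ar C" "Dom C e = Z" "Cod C e = D \<sharp> Z" "Z \<in> Ob C" for e Z
    using theI'[OF ex1[OF that]] that(2) unfolding dag_def by simp
  have dag_eq: "s = dag e"
    if "e \<in> Ar C" "Dom C e = Z" "Cod C e = D \<sharp> Z" "Z \<in> Ob C"
      "s \<in> Ar C" "Dom C s = Z" "Cod C s = D" "s = a \<cdot> ((\<one> D \<sharp>\<sharp> s) \<cdot> e)" for e Z s
    using ex1[OF that(1-4)] dag[OF that(1-4)] HomI[OF that(5-7)] that(8) by blast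
  have elgot: "complete_elgot_algebra C D a dag"
    by (rule unique_solutions_elgot[OF alg dag dag_eq])
  define eta where "eta = tuo \<cdot> Unit C D X"
  have eta [simp]: "eta \<in> Ar C" "Dom C eta = X" "Cod C eta = D" by (simp_all add: eta_def)
  \<comment> \<open>The identity solves this equation, and solutions are unique. This pins down the
    extension below.\<close>
  have id: "dag ((eta \<sharp>\<sharp> \<one> D) \<cdot> out) = \<one> D"
    by (rule dag_eq[where Z = D, symmetric]) (simp_all add: a_def eta_def)
  have "\<exists>!h. elgot_morphism C D dag B ddag h \<and> h \<cdot> eta = g"
    if B: "complete_elgot_algebra C B b ddag" and g: "g \<in> Hom C X B" for B b ddag g
  proof (rule ex1I)
    note [simp] = HomD[OF g] elgot_algebra_rules[OF B]
      sharp_algebra_rules[OF elgot_algebra_rules(1)[OF B]] elgot_algebra_rules[OF elgot]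
    let ?f = "(g \<sharp>\<sharp> \<one> D) \<cdot> out"
    let ?h = "ddag ?f"
    have "?h \<cdot> eta = (b \<cdot> ((\<one> B \<sharp>\<sharp> ?h) \<cdot> ?f)) \<cdot> eta"
      by (subst elgot_solution[OF B]) simp_all
    also have "\<dots> = g" by (simp add: eta_def)
    finally have "?h \<cdot> eta = g" .
    moreover have "elgot_morphism C D dag B ddag ?h"
    proof (rule elgot_morphismI)
      fix e Z assume e: "e \<in> Ar C" "Dom C e = Z" "Cod C e = D \<sharp> Z" "Z \<in> Ob C"
      show "ddag ((?h \<sharp>\<sharp> \<one> Z) \<cdot> e) = ?h \<cdot> dag e"
        by (rule iterated_coalgebra_preserves_solutions[OF B out X a oa])
          (use e in \<open>simp_all add: elgot_solution[OF elgot e(1-3)]\<close>)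
    qed simp_all
    ultimately show "elgot_morphism C D dag B ddag ?h \<and> ?h \<cdot> eta = g" by simp
    fix h assume h: "elgot_morphism C D dag B ddag h \<and> h \<cdot> eta = g"
    note [simp] = elgot_morphismD(1-3)[OF conjunct1[OF h]]
    \<comment> \<open>Any extension \<open>h\<close> maps the iterate \<open>id\<close> to the
      iterate of \<open>?f\<close>, because \<open>g\<close> factors as \<open>h\<close> after
      \<open>eta\<close>; this also shows where the witness \<open>?h\<close> comes from.\<close>
    have "?h = ddag ((h \<sharp>\<sharp> \<one> D) \<cdot> ((eta \<sharp>\<sharp> \<one> D) \<cdot> out))" using h by simp
    also have "\<dots> = h"
      by (subst elgot_morphismD(4)[OF conjunct1[OF h]]) (simp_all add: id)
    finally show "h = ?h" ..
  qed
  then have "free_complete_elgot_algebra C X D a dag eta"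
    using elgot HomI[OF eta] unfolding free_complete_elgot_algebra_def by blast
  then show ?thesis unfolding a_def eta_def tuo_def by blast
qed

section \<open>From free algebras to final coalgebras\<close>

theorem free_elgot_final_coalgebra:
  assumes X [simp]: "X \<in> Ob C" and free: "free_complete_elgot_algebra C X F \<phi> dag \<eta>"
  shows "is_iso C (\<phi> \<cdot> (\<eta> \<sharp>\<sharp> \<one> F))"
    and "final_coalgebra C (\<lambda>Y. X \<sharp> Y) (\<lambda>h. \<one> X \<sharp>\<sharp> h) F (inverse_of C (\<phi> \<cdot> (\<eta> \<sharp>\<sharp> \<one> F)))"
proof -
  have F: "complete_elgot_algebra C F \<phi> dag"
    and eta [simp]: "\<eta> \<in> Ar C" "Dom C \<eta> = X" "Cod C \<eta> = F"
    and univ: "\<And>B b ddag g. complete_elgot_algebra C B b ddag \<Longrightarrow> g \<in> Hom C X B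
      \<Longrightarrow> \<exists>!h. elgot_morphism C F dag B ddag h \<and> h \<cdot> \<eta> = g"
    using free by (auto simp: free_complete_elgot_algebra_def Hom_def)
  note [simp] = elgot_algebra_rules[OF F] sharp_algebra_rules[OF elgot_algebra_rules(1)[OF F]]
  have id_unique: "h = \<one> F" if "elgot_morphism C F dag F dag h" "h \<cdot> \<eta> = \<eta>" for h
  proof -
    have "elgot_morphism C F dag F dag (\<one> F)" by (rule elgot_morphismI) auto
    then show ?thesis using univ[OF F HomI[OF eta]] that eta by (metis Id_comp)
  qed

  define \<alpha> where "\<alpha> = \<phi> \<cdot> (\<eta> \<sharp>\<sharp> \<one> F)"
  have al [simp]: "\<alpha> \<in> Ar C" "Dom C \<alpha> = X \<sharp> F" "Cod C \<alpha> = F" by (simp_all add: \<alpha>_def)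
  define \<psi> where "\<psi> = Mult C F X \<cdot> (\<one> (X \<sharp> F) \<sharp>\<sharp> \<alpha>)"
  define lift where "lift e = (\<alpha> \<sharp>\<sharp> \<one> (Dom C e)) \<cdot> e" for e
  \<comment> \<open>Iterate in \<open>F\<close> after pushing outputs there along
    \<open>\<alpha>\<close>, then unroll \<open>e\<close> once to return to
    \<open>X \<sharp> F\<close>.\<close>
  define ddag where "ddag e = Mult C F X \<cdot> ((\<one> (X \<sharp> F) \<sharp>\<sharp> dag (lift e)) \<cdot> e)" for e
  have lift [simp]: "lift e \<in> Ar C" "Dom C (lift e) = Z" "Cod C (lift e) = F \<sharp> Z"
    if "e \<in> Ar C" "Dom C e = Z" "Cod C e = X \<sharp> F \<sharp> Z" for e Z
    using that Dom_Ob[of e] by (auto simp: lift_def)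
  have ddag [simp]: "ddag e \<in> Ar C" "Dom C (ddag e) = Z" "Cod C (ddag e) = X \<sharp> F"
    if "e \<in> Ar C" "Dom C e = Z" "Cod C e = X \<sharp> F \<sharp> Z" for e Z
    using that by (simp_all add: ddag_def)
  have al_m: "\<alpha> \<cdot> (Mult C F X \<cdot> k) = \<phi> \<cdot> ((\<alpha> \<sharp>\<sharp> \<one> F) \<cdot> k)"
    if "k \<in> Ar C" "Cod C k = X \<sharp> F \<sharp> F" for k
    using that by (simp add: \<alpha>_def)
  have al_ddag: "\<alpha> \<cdot> ddag e = dag (lift e)"
    if [simp]: "e \<in> Ar C" "Dom C e = Z" "Cod C e = X \<sharp> F \<sharp> Z" for e Z
  proof -
    have [simp]: "Z \<in> Ob C" using Dom_Ob[of e] by simp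
    have "\<alpha> \<cdot> ddag e = \<phi> \<cdot> ((\<one> F \<sharp>\<sharp> dag (lift e)) \<cdot> lift e)"
      by (simp add: ddag_def al_m) (simp add: lift_def)
    also have "\<dots> = dag (lift e)" by (rule elgot_solution[OF F]) simp_all
    finally show ?thesis .
  qed
  have psi: "\<psi> \<in> Hom C (X \<sharp> F \<sharp> (X \<sharp> F)) (X \<sharp> F)" by (auto simp: \<psi>_def intro!: HomI)
  have G: "complete_elgot_algebra C (X \<sharp> F) \<psi> ddag"
    unfolding complete_elgot_algebra_def
  proof (intro conjI ballI impI)
    show "sharp_algebra C (X \<sharp> F) \<psi>"
      unfolding sharp_algebra_def using psi by (simp add: \<psi>_def)
  next
    fix Z e assume "Z \<in> Ob C" "e \<in> Hom C Z (X \<sharp> F \<sharp> Z)"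
    note [simp] = this(1) HomD[OF this(2)]
    show "ddag e \<in> Hom C Z (X \<sharp> F)" by (auto intro!: HomI)
    \<comment> \<open>\<open>\<psi>\<close> applies \<open>\<alpha>\<close> to its parameter, and
      \<open>\<alpha>\<close> turns \<open>ddag e\<close> back into the iterate in \<open>F\<close>,
      so the right side is the definition of \<open>ddag e\<close>.\<close>
    have "\<psi> \<cdot> (\<one> (X \<sharp> F) \<sharp>\<sharp> ddag e) \<cdot> e = Mult C F X \<cdot> ((\<one> (X \<sharp> F) \<sharp>\<sharp> (\<alpha> \<cdot> ddag e)) \<cdot> e)"
      by (simp add: \<psi>_def)
    also have "\<dots> = ddag e" by (simp add: al_ddag[of e Z]) (simp add: ddag_def)
    finally show "ddag e = \<psi> \<cdot> (\<one> (X \<sharp> F) \<sharp>\<sharp> ddag e) \<cdot> e" ..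
  next
    fix Z Y e f h
    assume "Z \<in> Ob C" "Y \<in> Ob C" "e \<in> Hom C Z (X \<sharp> F \<sharp> Z)" "f \<in> Hom C Y (X \<sharp> F \<sharp> Y)" "h \<in> Hom C Z Y"
    note [simp] = this(1,2) HomD[OF this(3)] HomD[OF this(4)] HomD[OF this(5)]
    assume fh: "f \<cdot> h = (\<one> (X \<sharp> F) \<sharp>\<sharp> h) \<cdot> e"
    have "dag (lift f) \<cdot> h = dag (lift e)"
      by (rule elgot_functoriality[OF F, of _ Z _ Y]) (simp_all, simp add: lift_def fh)
    then show "ddag f \<cdot> h = ddag e" by (simp add: ddag_def fh)
  next
    fix Z Y f g
    assume "Z \<in> Ob C" "Y \<in> Ob C" "f \<in> Hom C Y (X \<sharp> F \<sharp> Y)" "g \<in> Hom C Z (Y \<sharp> Z)"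
    note [simp] = this(1,2) HomD[OF this(3)] HomD[OF this(4)]
    let ?bs = "black_square C (X \<sharp> F) Y Z f g"
    let ?s = "dag (lift ?bs)"
    have bs: "lift ?bs = black_square C F Y Z (lift f) g"
      by (simp add: lift_def TAr_black_square[where A = "X \<sharp> F"])
    have l: "?s \<cdot> Inj1 C Y Z = dag (lift f)"
      unfolding bs by (rule elgot_functoriality[OF F, of _ Y _ "Y \<boxplus> Z"]) simp_all
    have r: "dag (lift ((ddag f \<sharp>\<sharp> \<one> Z) \<cdot> g)) = ?s \<cdot> Inj2 C Y Z"
    proof -
      have "lift ((ddag f \<sharp>\<sharp> \<one> Z) \<cdot> g) = (dag (lift f) \<sharp>\<sharp> \<one> Z) \<cdot> g"
        unfolding lift_def[of "(ddag f \<sharp>\<sharp> \<one> Z) \<cdot> g"] by (simp add: al_ddag[of f Y])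
      then show ?thesis unfolding bs by (subst elgot_compositionality[OF F]) simp_all
    qed
    have "ddag ?bs \<cdot> Inj2 C Y Z = Mult C F X \<cdot> ((ddag f \<sharp>\<sharp> (?s \<cdot> Inj2 C Y Z)) \<cdot> g)"
      by (simp add: ddag_def l)
    also have "\<dots> = ddag ((ddag f \<sharp>\<sharp> \<one> Z) \<cdot> g)"
      by (simp add: ddag_def[of "(ddag f \<sharp>\<sharp> \<one> Z) \<cdot> g"] r)
    finally show "ddag ?bs \<cdot> Inj2 C Y Z = ddag (bullet C Z (ddag f) g)"
      unfolding bullet_def .
  qed
  have al_mor: "elgot_morphism C (X \<sharp> F) ddag F dag \<alpha>"
    by (rule elgot_morphismI) (simp_all add: al_ddag, simp add: lift_def)
  obtain \<beta> where be_mor: "elgot_morphism C F dag (X \<sharp> F) ddag \<beta>" and be_eta: "\<beta> \<cdot> \<eta> = Unit C F X"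
    using univ[OF G Unit_Hom] by auto
  note be [simp] = elgot_morphismD(1-3)[OF be_mor]
  have ab: "\<alpha> \<cdot> \<beta> = \<one> F"
    \<comment> \<open>The composite fixes \<open>\<eta>\<close>: \<open>\<beta>\<close> sends it to
      the unit, and \<open>\<alpha>\<close> after the unit is \<open>\<eta>\<close> by the unit law
      of \<open>\<phi>\<close>.\<close>
    by (rule id_unique[OF elgot_morphism_comp[OF F be_mor al_mor]]) (simp add: be_eta, simp add: \<alpha>_def)
  \<comment> \<open>Preservation of structure maps puts \<open>\<alpha> \<cdot> \<beta>\<close> in
    the parameter of \<open>\<psi>\<close>, where it cancels. The result is also the hypothesis
    \<open>ca\<close> needed for the coalgebra \<open>\<beta>\<close>.\<close>
  have be_phi: "\<beta> \<cdot> \<phi> = Mult C F X \<cdot> (\<beta> \<sharp>\<sharp> \<one> F)"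
    using elgot_morphism_algebra_morphism[OF F G be_mor] by (simp add: \<psi>_def ab)
  have "\<beta> \<cdot> \<alpha> = (\<beta> \<cdot> \<phi>) \<cdot> (\<eta> \<sharp>\<sharp> \<one> F)" by (simp add: \<alpha>_def)
  also have "\<dots> = \<one> (X \<sharp> F)" by (simp add: be_phi be_eta)
  finally have ba: "\<beta> \<cdot> \<alpha> = \<one> (X \<sharp> F)" .
  have inv: "is_inverse C \<alpha> \<beta>" using ab ba by (auto simp: is_inverse_def intro!: HomI)
  then show iso: "is_iso C (\<phi> \<cdot> (\<eta> \<sharp>\<sharp> \<one> F))" unfolding is_iso_def \<alpha>_def by blast
  have be_inv: "\<beta> = inverse_of C \<alpha>"
  proof -
    have i: "is_inverse C \<alpha> (inverse_of C \<alpha>)" using inverse_of_is_inverse iso unfolding \<alpha>_def by blast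
    then have [simp]: "inverse_of C \<alpha> \<in> Ar C" "Dom C (inverse_of C \<alpha>) = F" "Cod C (inverse_of C \<alpha>) = X \<sharp> F"
      and "inverse_of C \<alpha> \<cdot> \<alpha> = \<one> (X \<sharp> F)" by (auto simp: is_inverse_def Hom_def)
    then have "(inverse_of C \<alpha> \<cdot> \<alpha>) \<cdot> \<beta> = \<beta>" by simp
    then show ?thesis by (simp add: ab)
  qed

  define w where "w = dag ((\<eta> \<sharp>\<sharp> \<one> F) \<cdot> \<beta>)"
  have w [simp]: "w \<in> Ar C" "Dom C w = F" "Cod C w = F" by (simp_all add: w_def)
  have w_id: "w = \<one> F"
  proof (rule id_unique)
    show "elgot_morphism C F dag F dag w"
    proof (rule elgot_morphismI)
      fix e Z assume e: "e \<in> Ar C" "Dom C e = Z" "Cod C e = F \<sharp> Z" "Z \<in> Ob C"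
      show "dag ((w \<sharp>\<sharp> \<one> Z) \<cdot> e) = w \<cdot> dag e"
        unfolding w_def
        by (rule iterated_coalgebra_preserves_solutions[OF F be X _ _ _ be_phi])
          (use e in \<open>simp_all add: elgot_solution[OF F e(1-3)]\<close>)
    qed simp_all
    have "w \<cdot> \<eta> = (\<phi> \<cdot> ((\<one> F \<sharp>\<sharp> w) \<cdot> ((\<eta> \<sharp>\<sharp> \<one> F) \<cdot> \<beta>))) \<cdot> \<eta>"
      unfolding w_def by (subst elgot_solution[OF F]) simp_all
    then show "w \<cdot> \<eta> = \<eta>" by (simp add: be_eta)
  qed
  have "\<exists>!t. coalgebra_morphism C (\<lambda>h. \<one> X \<sharp>\<sharp> h) Y d F \<beta> t"
    if "coalgebra C (\<lambda>Y. X \<sharp> Y) Y d" for Y d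
  proof (rule ex1I)
    have [simp]: "Y \<in> Ob C" "d \<in> Ar C" "Dom C d = Y" "Cod C d = X \<sharp> Y"
      using that by (auto simp: coalgebra_def Hom_def)
    let ?t = "dag ((\<eta> \<sharp>\<sharp> \<one> Y) \<cdot> d)"
    \<comment> \<open>Since \<open>\<alpha>\<close> absorbs \<open>\<eta>\<close>, the solution
      equation says that \<open>?t\<close> is \<open>\<alpha>\<close> after
      \<open>(\<one> X \<sharp>\<sharp> ?t) \<cdot> d\<close>; composing with \<open>\<beta>\<close>
      gives the morphism equation.\<close>
    have "?t = \<phi> \<cdot> ((\<one> F \<sharp>\<sharp> ?t) \<cdot> ((\<eta> \<sharp>\<sharp> \<one> Y) \<cdot> d))"
      by (subst elgot_solution[OF F]) simp_all
    also have "\<dots> = \<alpha> \<cdot> ((\<one> X \<sharp>\<sharp> ?t) \<cdot> d)" by (simp add: \<alpha>_def)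
    finally have "\<beta> \<cdot> ?t = (\<beta> \<cdot> \<alpha>) \<cdot> ((\<one> X \<sharp>\<sharp> ?t) \<cdot> d)" by simp
    then show "coalgebra_morphism C (\<lambda>h. \<one> X \<sharp>\<sharp> h) Y d F \<beta> ?t"
      unfolding ba by (auto simp: coalgebra_morphism_def intro!: HomI)
    fix t assume "coalgebra_morphism C (\<lambda>h. \<one> X \<sharp>\<sharp> h) Y d F \<beta> t"
    then have [simp]: "t \<in> Ar C" "Dom C t = Y" "Cod C t = F" and t: "\<beta> \<cdot> t = (\<one> X \<sharp>\<sharp> t) \<cdot> d"
      by (auto simp: coalgebra_morphism_def Hom_def)
    \<comment> \<open>A coalgebra morphism \<open>t\<close> into \<open>\<beta>\<close> is a
      homomorphism between the equations obtained by pushing outputs along \<open>\<eta>\<close>, so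
      functoriality relates their iterates.\<close>
    have "w \<cdot> t = ?t"
      unfolding w_def by (rule elgot_functoriality[OF F, of _ Y _ F]) (simp_all add: t)
    then show "t = ?t" by (simp add: w_id)
  qed
  moreover have "coalgebra C (\<lambda>Y. X \<sharp> Y) F \<beta>" by (auto simp: coalgebra_def intro!: HomI)
  ultimately show "final_coalgebra C (\<lambda>Y. X \<sharp> Y) (\<lambda>h. \<one> X \<sharp>\<sharp> h) F (inverse_of C (\<phi> \<cdot> (\<eta> \<sharp>\<sharp> \<one> F)))"
    unfolding final_coalgebra_def using be_inv by (simp add: \<alpha>_def)
qed

end

theorem theorem4p14:
  fixes C :: "('o, 'm, 'x) pmonad_cat_scheme" (structure) and X :: 'o
  assumes "finite_coproducts C" and "parametrized_monad C" and "X \<in> Ob C"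
  shows
    "(\<forall>\<Phi> out. final_coalgebra C (\<lambda>Y. X \<sharp> Y) (\<lambda>h. \<one> X \<sharp>\<sharp> h) \<Phi> out \<longrightarrow>
        (\<exists>dag. free_complete_elgot_algebra C X \<Phi>
          (inverse_of C out \<cdot> Mult C \<Phi> X \<cdot> (out \<sharp>\<sharp> \<one> \<Phi>)) dag
          (inverse_of C out \<cdot> Unit C \<Phi> X))) \<and>
     (\<forall>F \<phi> dag \<eta>. free_complete_elgot_algebra C X F \<phi> dag \<eta> \<longrightarrow>
        is_iso C (\<phi> \<cdot> (\<eta> \<sharp>\<sharp> \<one> F)) \<and>
        final_coalgebra C (\<lambda>Y. X \<sharp> Y) (\<lambda>h. \<one> X \<sharp>\<sharp> h) F
          (inverse_of C (\<phi> \<cdot> (\<eta> \<sharp>\<sharp> \<one> F))))"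
proof -
  interpret coproduct_pmonad C by (intro coproduct_pmonad.intro assms(1,2))
  show ?thesis
    using final_coalgebra_free_elgot[OF assms(3)] free_elgot_final_coalgebra[OF assms(3)] by blast
qed

end
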